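(* For any connected weighted signed graph $\Gamma=(G,\gamma)$ and any real number $\varepsilon>0$ there is a consistent weighting $\gamma'$ of the edges of $G$ such that $\|\gamma-\gamma'\|<\varepsilon$ and $L(G,\gamma')$ has only simple eigenvalues. In other words, the set of consistent weightings of a connected signed graph $G$ for which the Laplacian matrix has all of its eigenvalues simple is dense in the set of all consistent weightings of $G$.
   Context: A signed graph is a simple graph $G=(V(G),E(G))$ with vertex set $V(G)=\{1,\dots,n\}$ together with an assignment of a sign $+$ or $-$ to each edge. A consistent weighting $\gamma$ of $G$ assigns to each edge $ij$ a nonzero real number $\gamma_{ij}$ whose sign is the sign of the edge; $\Gamma=(G,\gamma)$ is then a weighted signed graph, and it is connected if $G$ is. For any assignment $\gamma$ of real weights to the edges of $G$, the Laplacian is $L(G,\gamma)=A-D$, where $A=[a_{ij}]$ is the symmetric $n\times n$ matrix with $a_{ij}=\gamma_{ij}$ if $ij\in E(G)$ and $a_{ij}=0$ otherwise, and $D=\mathrm{diag}(d_1,\dots,d_n)$ with $d_i$ the sum of the weights of the edges incident to vertex $i$. The norm of a weighting is $\|\gamma\|=\|L(G,\gamma)\|_2$ (the matrix 2-norm), so that $\|\gamma-\gamma'\|=\|L(G,\gamma)-L(G,\gamma')\|_2$. *)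

theory Defs
  imports
    "HOL-Analysis.Analysis"
    "HOL-Computational_Algebra.Polynomial"
begin

(* The vertex set is a finite type 'n, so n = CARD('n). A simple graph is given by its set E
   of edges, each edge being the two-element set of its endpoints. *)

definition simple_graph :: "'v set set \<Rightarrow> bool" where
  "simple_graph E \<longleftrightarrow> (\<forall>e\<in>E. \<exists>i j. i \<noteq> j \<and> e = {i, j})"

definition connected_graph :: "'v set set \<Rightarrow> bool" where
  "connected_graph E \<longleftrightarrow> (\<forall>i j. (i, j) \<in> {(u, v). {u, v} \<in> E}\<^sup>*)"

datatype sign = Plus | Minus

fun has_sign :: "real \<Rightarrow> sign \<Rightarrow> bool" where
  "has_sign x Plus \<longleftrightarrow> x > 0"
| "has_sign x Minus \<longleftrightarrow> x < 0"

(* A signed graph is a simple graph E with \<sigma> assigning a sign to each edge; the values of \<sigma>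
   off E are irrelevant. The extensional function space makes a weighting a function on E only,
   so that distinct elements differ on some edge. *)

definition consistent_weightings :: "'v set set \<Rightarrow> ('v set \<Rightarrow> sign) \<Rightarrow> ('v set \<Rightarrow> real) set" where
  "consistent_weightings E \<sigma> = (\<Pi>\<^sub>E e\<in>E. {x. has_sign x (\<sigma> e)})"

definition adjacency_matrix :: "'n::finite set set \<Rightarrow> ('n set \<Rightarrow> real) \<Rightarrow> real^'n^'n" where
  "adjacency_matrix E \<gamma> = (\<chi> i j. if {i, j} \<in> E then \<gamma> {i, j} else 0)"

definition degree_matrix :: "'n::finite set set \<Rightarrow> ('n set \<Rightarrow> real) \<Rightarrow> real^'n^'n" where
  "degree_matrix E \<gamma> = (\<chi> i j. if i = j then \<Sum>e | e \<in> E \<and> i \<in> e. \<gamma> e else 0)"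

(* Sign convention: A - D, the negative of the usual Laplacian. *)
definition laplacian :: "'n::finite set set \<Rightarrow> ('n set \<Rightarrow> real) \<Rightarrow> real^'n^'n" where
  "laplacian E \<gamma> = adjacency_matrix E \<gamma> - degree_matrix E \<gamma>"

definition weighting_norm :: "'n::finite set set \<Rightarrow> ('n set \<Rightarrow> real) \<Rightarrow> real" where
  "weighting_norm E \<gamma> = onorm ((*v) (laplacian E \<gamma>))"

definition weighting_dist ::
    "'n::finite set set \<Rightarrow> ('n set \<Rightarrow> real) \<Rightarrow> ('n set \<Rightarrow> real) \<Rightarrow> real" where
  "weighting_dist E \<gamma> \<gamma>' = weighting_norm E (\<lambda>e. \<gamma> e - \<gamma>' e)"

definition eigenvalue :: "'a::field^'n^'n \<Rightarrow> 'a \<Rightarrow> bool" where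
  "eigenvalue M \<mu> \<longleftrightarrow> (\<exists>v. v \<noteq> 0 \<and> M *v v = \<mu> *s v)"

definition charpoly :: "'a::comm_ring_1^'n^'n \<Rightarrow> 'a poly" where
  "charpoly M = det (mat [:0, 1:] - map_matrix (\<lambda>a. [:a:]) M)"

(* Simple means of algebraic multiplicity one. All complex eigenvalues of the real matrix M are
   considered, so the definition does not presuppose that its spectrum is real. *)
definition only_simple_eigenvalues :: "real^'n^'n \<Rightarrow> bool" where
  "only_simple_eigenvalues M \<longleftrightarrow>
     (let M' = map_matrix complex_of_real M
      in \<forall>\<mu>. eigenvalue M' \<mu> \<longrightarrow> order \<mu> (charpoly M') = 1)"

lemma laplacian_diff:
  "laplacian E (\<lambda>e. \<gamma> e - \<gamma>' e) = laplacian E \<gamma> - laplacian E \<gamma>'"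
  by (simp add: laplacian_def adjacency_matrix_def degree_matrix_def vec_eq_iff sum_subtractf)

lemma weighting_dist_eq:
  "weighting_dist E \<gamma> \<gamma>' = onorm (\<lambda>x. laplacian E \<gamma> *v x - laplacian E \<gamma>' *v x)"
  unfolding weighting_dist_def weighting_norm_def laplacian_diff
  by (rule arg_cong[where f = onorm]) (simp add: fun_eq_iff matrix_vector_mult_diff_rdistrib)

lemma laplacian_eq_imp_eq:
  assumes E: "simple_graph E" and "\<gamma> \<in> consistent_weightings E \<sigma>"
    and "\<gamma>' \<in> consistent_weightings E \<sigma>" and eq: "laplacian E \<gamma> = laplacian E \<gamma>'"
  shows "\<gamma> = \<gamma>'"
proof (rule PiE_ext)
  show "\<gamma> \<in> (\<Pi>\<^sub>E e\<in>E. {x. has_sign x (\<sigma> e)})" "\<gamma>' \<in> (\<Pi>\<^sub>E e\<in>E. {x. has_sign x (\<sigma> e)})"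
    using assms by (auto simp: consistent_weightings_def)
  fix e assume e: "e \<in> E"
  then obtain i j where ij: "i \<noteq> j" "e = {i, j}"
    using E by (auto simp: simple_graph_def)
  have "laplacian E \<gamma> $ i $ j = laplacian E \<gamma>' $ i $ j" using eq by simp
  then show "\<gamma> e = \<gamma>' e"
    using e ij by (simp add: laplacian_def adjacency_matrix_def degree_matrix_def)
qed

lemma Metric_space_weightings:
  assumes "simple_graph E"
  shows "Metric_space (consistent_weightings E \<sigma>) (weighting_dist E)"
proof
  have bl: "bounded_linear (\<lambda>x. laplacian E \<gamma> *v x - laplacian E \<gamma>' *v x)" for \<gamma> \<gamma>'
    by (intro bounded_linear_sub matrix_vector_mul_bounded_linear)
  show "0 \<le> weighting_dist E \<gamma> \<gamma>'" for \<gamma> \<gamma>'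
    unfolding weighting_dist_eq by (rule onorm_pos_le[OF bl])
  show "weighting_dist E \<gamma> \<gamma>' = weighting_dist E \<gamma>' \<gamma>" for \<gamma> \<gamma>'
    unfolding weighting_dist_eq
    using onorm_neg[of "\<lambda>x. laplacian E \<gamma> *v x - laplacian E \<gamma>' *v x"] by simp
  show "weighting_dist E \<gamma> \<gamma>' = 0 \<longleftrightarrow> \<gamma> = \<gamma>'"
    if "\<gamma> \<in> consistent_weightings E \<sigma>" "\<gamma>' \<in> consistent_weightings E \<sigma>" for \<gamma> \<gamma>'
    unfolding weighting_dist_eq onorm_eq_0[OF bl]
    using laplacian_eq_imp_eq[OF assms that] by (auto simp: matrix_eq)
  show "weighting_dist E \<gamma> \<gamma>'' \<le> weighting_dist E \<gamma> \<gamma>' + weighting_dist E \<gamma>' \<gamma>''" for \<gamma> \<gamma>' \<gamma>''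
    using onorm_triangle[OF bl[of \<gamma> \<gamma>'] bl[of \<gamma>' \<gamma>'']] by (simp add: weighting_dist_eq)
qed

end

theory Submission
  imports Defs
begin

text \<open>
  A symmetric matrix none of whose eigenvectors vanishes at a fixed coordinate \<open>r\<close> has only simple
  eigenvalues, since any two independent eigenvectors for one eigenvalue could be combined into an
  eigenvector vanishing at \<open>r\<close>. For a symmetric matrix \<open>M\<close> the condition on \<open>r\<close> says that the vectors
  \<open>M\<^sup>k e\<^sub>r\<close> span the whole space, that is, some determinant formed from \<open>n\<close> of them is nonzero.
  Along a line of weightings such a determinant is a polynomial in the parameter, so one weighting
  with the property, of any signs, yields such weightings arbitrarily close to a given one.

  A weighting with the property is built by growing a tree from \<open>r\<close>, giving each new edge \<open>uv\<close> a
  small weight. If eigenvectors vanishing at \<open>r\<close> persisted as this weight tends to 0, they would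
  converge to a multiple of \<open>e\<^sub>v\<close>. Their eigenvalues are nonzero, so their entries sum to 0 because
  the Laplacian has zero column sums; hence the limit would be 0, although it has norm 1.
\<close>

section \<open>Symmetric matrices with simple spectrum\<close>

lemma inner_symmetric_matrix:
  fixes M :: "real^'n^'n"
  assumes "transpose M = M"
  shows "x \<bullet> (M *v y) = (M *v x) \<bullet> y"
  using assms dot_lmul_matrix[of x M y] by (metis transpose_matrix_vector)

text \<open>Serves in place of the full spectral theorem: if a suitable family of vectors failed to
  span, its orthogonal complement would be such a \<open>W\<close> and would contain an
  eigenvector.\<close>

lemma symmetric_invariant_subspace_eigenvector:
  fixes M :: "real^'n^'n"
  assumes sym: "transpose M = M" and W: "subspace W"
    and inv: "\<And>x. x \<in> W \<Longrightarrow> M *v x \<in> W" and ne: "\<exists>w\<in>W. w \<noteq> 0"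
  obtains x l where "x \<in> W" "x \<noteq> 0" "M *v x = l *\<^sub>R x"
proof -
  \<comment> \<open>A maximiser of the Rayleigh quotient on \<open>W\<close> is an eigenvector.\<close>
  let ?K = "sphere 0 1 \<inter> W"
  have cpt: "compact ?K"
    using closed_subspace[OF W] by (intro compact_Int_closed) auto
  obtain w where w: "w \<in> W" "w \<noteq> 0" using ne by blast
  then have "(1 / norm w) *\<^sub>R w \<in> ?K"
    using W by (auto simp: subspace_scale)
  then have "?K \<noteq> {}" by blast
  moreover have "continuous_on ?K (\<lambda>x. x \<bullet> (M *v x))"
    by (intro continuous_intros linear_continuous_on matrix_vector_mul_bounded_linear)
  ultimately obtain x where x: "x \<in> ?K" and mx: "\<And>y. y \<in> ?K \<Longrightarrow> y \<bullet> (M *v y) \<le> x \<bullet> (M *v x)"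
    using continuous_attains_sup[OF cpt] by blast
  define m where "m = x \<bullet> (M *v x)"
  \<comment> \<open>The residual of the eigenvalue equation stays in \<open>W\<close>, so maximality
    of \<open>m\<close> can be tested in the direction \<open>y\<close>; the aim is
    \<open>y = 0\<close>.\<close>
  define y where "y = m *\<^sub>R x - M *v x"
  have xW: "x \<in> W" "norm x = 1" using x by auto
  have yW: "y \<in> W" unfolding y_def using W inv xW by (simp add: subspace_diff subspace_scale)
  have nonneg: "z \<bullet> (M *v z) \<le> m * (z \<bullet> z)" if "z \<in> W" for z
  proof (cases "z = 0")
    case False
    then have "(1 / norm z) *\<^sub>R z \<in> ?K" using that W by (auto simp: subspace_scale)
    from mx[OF this] have "(z \<bullet> (M *v z)) / (norm z)\<^sup>2 \<le> m"
      by (simp add: m_def matrix_vector_mult_scaleR power2_eq_square)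
    then show ?thesis using False by (simp add: field_simps power2_norm_eq_inner)
  qed simp
  \<comment> \<open>The form \<open>m * (z \<bullet> z) - z \<bullet> (M *v z)\<close> is
    nonnegative on \<open>W\<close> and zero at \<open>x\<close>. Along
    \<open>x + s *\<^sub>R y\<close> it is quadratic in \<open>s\<close> without constant term, so
    its linear coefficient must vanish.\<close>
  have *: "0 \<le> 2 * s * (y \<bullet> y) + s\<^sup>2 * (m * (y \<bullet> y) - y \<bullet> (M *v y))" for s
  proof -
    have "x + s *\<^sub>R y \<in> W" using W xW yW by (simp add: subspace_add subspace_scale)
    from nonneg[OF this] have "0 \<le> m * ((x + s *\<^sub>R y) \<bullet> (x + s *\<^sub>R y)) - (x + s *\<^sub>R y) \<bullet> (M *v (x + s *\<^sub>R y))"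
      by simp
    also have "\<dots> = (m * (x \<bullet> x) - m) + 2 * s * (m * (x \<bullet> y) - (M *v x) \<bullet> y)
        + s\<^sup>2 * (m * (y \<bullet> y) - y \<bullet> (M *v y))"
      using inner_symmetric_matrix[OF sym, of x y]
      by (simp add: m_def algebra_simps inner_add_left inner_add_right power2_eq_square
          matrix_vector_mult_scaleR inner_commute)
    also have "m * (x \<bullet> y) - (M *v x) \<bullet> y = y \<bullet> y"
      by (subst (3) y_def) (simp add: inner_diff_left)
    also have "x \<bullet> x = 1" using xW by (simp add: norm_eq_1)
    finally show ?thesis by simp
  qed
  have "y \<bullet> y = 0"
  proof (rule ccontr)
    define a where "a = y \<bullet> y"
    define b where "b = m * (y \<bullet> y) - y \<bullet> (M *v y)"
    assume "y \<bullet> y \<noteq> 0"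
    then have a: "a > 0" by (simp add: a_def)
    have b: "b \<ge> 0" using nonneg[OF yW] by (simp add: b_def)
    \<comment> \<open>For this negative \<open>s\<close> the linear term wins; dividing by
      \<open>b + 1\<close> rather than \<open>b\<close> also covers \<open>b = 0\<close>.\<close>
    have "0 \<le> 2 * (- (a / (b + 1))) * a + (- (a / (b + 1)))\<^sup>2 * b"
      using *[of "- (a / (b + 1))"] unfolding a_def b_def .
    also have "\<dots> = a\<^sup>2 / (b + 1) * (b / (b + 1) - 2)"
    proof -
      have "b = (b + 1) * (b / (b + 1))" using b by simp
      then have "(- (a / (b + 1)))\<^sup>2 * b = a\<^sup>2 / (b + 1) * (b / (b + 1))"
        using b by (simp add: power2_eq_square)
      then show ?thesis by (simp add: algebra_simps power2_eq_square)
    qed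
    also have "\<dots> < 0"
      using a b by (intro mult_pos_neg) (auto simp: field_simps)
    finally show False by simp
  qed
  then have "M *v x = m *\<^sub>R x" by (simp add: y_def)
  with that xW show ?thesis by force
qed

section \<open>Krylov vectors of a root coordinate\<close>

text \<open>Indexing the basis by the coordinate type itself lets its vectors be the rows of a
  square matrix with a determinant.\<close>

lemma spanning_set_indexed_basis:
  fixes S :: "(real^'n) set"
  assumes "span S = UNIV"
  obtains b :: "'n \<Rightarrow> real^'n" where "range b \<subseteq> S" "inj b" "independent (range b)" "det (\<chi> i. b i) \<noteq> 0"
proof -
  obtain B where B: "B \<subseteq> S" "independent B" "S \<subseteq> span B"
    using maximal_independent_subset by blast
  then have sp: "span B = UNIV"
    using assms by (metis span_mono span_span top.extremum_unique)
  then have "card B = CARD('n)" "finite B"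
    using B(2) by (metis dim_span dim_UNIV basis_card_eq_dim dim_eq_card DIM_cart DIM_real mult_1_right)
      (use B(2) independent_imp_finite in blast)
  then obtain b :: "'n \<Rightarrow> real^'n" where b: "bij_betw b UNIV B"
    by (metis finite_same_card_bij finite)
  have "rows (\<chi> i. b i) = B"
    using b by (auto simp: rows_def row_def bij_betw_def)
  then have "\<exists>C. C ** (\<chi> i. b i) = mat 1"
    using sp by (simp add: matrix_left_invertible_span_rows)
  then have "det (\<chi> i. b i) \<noteq> 0"
    by (metis invertible_det_nz invertible_left_inverse)
  then show ?thesis using that b B(1,2) by (auto simp: bij_betw_def)
qed

text \<open>\<open>U\<close> stands for the vertices reached so far and keeps all matrices at full
  size: if the weights vanish on edges not contained in \<open>U\<close>, the eigenvectors supported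
  in \<open>U\<close> are those of the graph on \<open>U\<close>.\<close>

definition rooted_simple :: "real^'n^'n \<Rightarrow> 'n set \<Rightarrow> 'n \<Rightarrow> bool" where
  "rooted_simple M U r \<longleftrightarrow>
     (\<forall>x l. M *v x = l *\<^sub>R x \<longrightarrow> (\<forall>i. i \<notin> U \<longrightarrow> x $ i = 0) \<longrightarrow> x $ r = 0 \<longrightarrow> x = 0)"

text \<open>The exponents are left free, so that any basis extracted from the Krylov sequence of
  \<open>axis r 1\<close> has this form.\<close>

definition krylov :: "real^'n^'n \<Rightarrow> 'n \<Rightarrow> ('n \<Rightarrow> nat) \<Rightarrow> real^'n^'n" where
  "krylov M r \<kappa> = (\<chi> i. (((*v) M) ^^ \<kappa> i) (axis r 1))"

text \<open>By symmetry the orthogonal complement of the sequence is invariant under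
  \<open>M\<close>. An eigenvector in it is orthogonal to \<open>c 0 = axis r 1\<close>, that is,
  vanishes at \<open>r\<close>.\<close>

lemma rooted_simple_krylov:
  fixes M :: "real^'n^'n"
  assumes sym: "transpose M = M" and rs: "rooted_simple M UNIV r"
  obtains \<kappa> where "det (krylov M r \<kappa>) \<noteq> 0"
proof -
  define c where "c k = (((*v) M) ^^ k) (axis r (1::real))" for k
  have "span (range c) = UNIV"
  proof (rule ccontr)
    assume "span (range c) \<noteq> UNIV"
    then obtain a where a: "a \<noteq> 0" "\<And>x. x \<in> span (range c) \<Longrightarrow> a \<bullet> x = 0"
      using span_not_UNIV_orthogonal by blast
    define W where "W = {x. \<forall>k. x \<bullet> c k = 0}"
    have "a \<in> W" using a(2) by (auto simp: W_def span_base)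
    moreover have "subspace W" by (auto simp: W_def subspace_def inner_add_left)
    moreover have "M *v x \<in> W" if "x \<in> W" for x
    proof -
      have "(M *v x) \<bullet> c k = x \<bullet> c (Suc k)" for k
        by (simp add: c_def inner_symmetric_matrix[OF sym])
      then show ?thesis using that by (simp add: W_def)
    qed
    ultimately obtain x l where x: "x \<in> W" "x \<noteq> 0" "M *v x = l *\<^sub>R x"
      using symmetric_invariant_subspace_eigenvector[OF sym] a(1) by metis
    have "x \<bullet> c 0 = 0" using x(1) by (simp add: W_def)
    then have "x $ r = 0" by (simp add: c_def inner_axis)
    with x rs show False by (auto simp: rooted_simple_def)
  qed
  then obtain b :: "'n \<Rightarrow> real^'n" where b: "range b \<subseteq> range c" "det (\<chi> i. b i) \<noteq> 0"
    using spanning_set_indexed_basis by metis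
  then have "\<forall>i. \<exists>k. b i = c k" by blast
  then obtain \<kappa> where "\<And>i. b i = c (\<kappa> i)" by metis
  then have "krylov M r \<kappa> = (\<chi> i. b i)" by (simp add: krylov_def c_def)
  with b that show ?thesis by metis
qed

text \<open>By symmetry, powers of \<open>M\<close> move onto the eigenvector \<open>x\<close> and
  become powers of \<open>l\<close>; if \<open>x $ r = 0\<close>, every row of the Krylov matrix is
  orthogonal to \<open>x\<close>.\<close>

lemma krylov_rooted_simple:
  fixes M :: "real^'n^'n"
  assumes sym: "transpose M = M" and det: "det (krylov M r \<kappa>) \<noteq> 0"
  shows "rooted_simple M UNIV r"
  unfolding rooted_simple_def
proof (intro allI impI)
  fix x l assume x: "M *v x = l *\<^sub>R x" "x $ r = 0"
  have "(((*v) M) ^^ k) (axis r 1) \<bullet> x = 0" for k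
  proof (induction k)
    case 0
    then show ?case using x by (simp add: inner_axis inner_commute)
  next
    case (Suc k)
    have "(((*v) M) ^^ Suc k) (axis r 1) \<bullet> x = (((*v) M) ^^ k) (axis r 1) \<bullet> (M *v x)"
      by (simp add: inner_symmetric_matrix[OF sym])
    then show ?case using Suc x by simp
  qed
  then have "krylov M r \<kappa> *v x = 0"
    by (simp add: vec_eq_iff matrix_vector_mul_component krylov_def)
  then show "x = 0"
    using det by (metis invertible_det_nz invertible_left_inverse matrix_left_invertible_ker)
qed

section \<open>The characteristic polynomial from an eigenbasis\<close>

lemma poly_charpoly:
  "poly (charpoly M) z = det (mat z - M)"
proof -
  \<comment> \<open>The Leibniz formula contains the sign of each permutation as an integer cast
    into the polynomial ring.\<close>
  have "poly (of_int k) z = of_int k" for k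
    by (cases k) (simp_all add: of_nat_poly)
  moreover have "poly ((mat [:0, 1:] - map_matrix (\<lambda>a. [:a:]) M) $ i $ j) z = (mat z - M) $ i $ j" for i j
    by (simp add: mat_def map_matrix_def)
  ultimately show ?thesis
    unfolding charpoly_def det_def poly_sum poly_mult poly_prod by simp
qed

lemma det_complex_of_real:
  "det (map_matrix complex_of_real A) = complex_of_real (det A)"
  by (simp add: det_def map_matrix_def)

lemma order_prod_linear:
  fixes l :: "'n::finite \<Rightarrow> 'a::idom"
  assumes "inj l" 
  shows "order (l j) (\<Prod>i\<in>UNIV. [:- l i, 1:]) = 1"
proof -
  let ?q = "\<Prod>i\<in>UNIV - {j}. [:- l i, 1:]"
  have eq: "(\<Prod>i\<in>UNIV. [:- l i, 1:]) = [:- l j, 1:] * ?q"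
    by (rule prod.remove) auto
  have "poly ?q (l j) \<noteq> 0"
    using assms by (auto simp: poly_prod prod_zero_iff dest: injD)
  then have "order (l j) ?q = 0" "?q \<noteq> 0" by (auto simp: order_0I)
  moreover have "order (l j) [:- l j, 1:] = 1"
    using order_power_n_n[of "l j" 1] by simp
  ultimately show ?thesis
    by (subst eq, subst order_mult) (auto simp del: mult_pCons_left)
qed

text \<open>Symmetry yields a basis of real eigenvectors, and the condition at \<open>r\<close>
  separates their eigenvalues. The characteristic polynomial is then a product of distinct linear
  factors.\<close>

lemma rooted_simple_imp_only_simple_eigenvalues:
  fixes M :: "real^'n^'n"
  assumes sym: "transpose M = M" and rs: "rooted_simple M UNIV r"
  shows "only_simple_eigenvalues M"
proof -
  define S where "S = {x. x \<noteq> 0 \<and> (\<exists>l. M *v x = l *\<^sub>R x)}"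
  have "span S = UNIV"
  proof (rule ccontr)
    assume "span S \<noteq> UNIV"
    then obtain a where a: "a \<noteq> 0" "\<And>x. x \<in> span S \<Longrightarrow> a \<bullet> x = 0"
      using span_not_UNIV_orthogonal by blast
    define W where "W = {x. \<forall>s\<in>S. x \<bullet> s = 0}"
    have "a \<in> W" using a(2) by (auto simp: W_def span_base)
    moreover have "subspace W" by (auto simp: W_def subspace_def inner_add_left)
    moreover have "M *v x \<in> W" if "x \<in> W" for x
      using that by (auto simp: W_def S_def inner_symmetric_matrix[OF sym, symmetric])
    ultimately obtain x l where x: "x \<in> W" "x \<noteq> 0" "M *v x = l *\<^sub>R x"
      using symmetric_invariant_subspace_eigenvector[OF sym] a(1) by metis
    then have "x \<in> S" by (auto simp: S_def)
    then have "x \<bullet> x = 0" using x(1) by (simp add: W_def)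
    with x show False by simp
  qed
  then obtain b :: "'n \<Rightarrow> real^'n" where b: "range b \<subseteq> S" "inj b" "independent (range b)" "det (\<chi> i. b i) \<noteq> 0"
    using spanning_set_indexed_basis by metis
  then have "\<forall>i. \<exists>l. M *v b i = l *\<^sub>R b i" by (auto simp: S_def)
  then obtain l where l: "\<And>i. M *v b i = l i *\<^sub>R b i" by metis
  have b0: "b i \<noteq> 0" for i using b(1) by (auto simp: S_def)
  have br: "b i $ r \<noteq> 0" for i using rs l[of i] b0[of i] by (auto simp: rooted_simple_def)
  let ?P = "\<chi> i. b i"
  have "inj l"
  proof (rule injI, rule ccontr)
    fix i j assume ij: "l i = l j" "i \<noteq> j"
    let ?x = "(b j $ r) *\<^sub>R b i - (b i $ r) *\<^sub>R b j"
    have "M *v ?x = l i *\<^sub>R ?x" 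
      using ij by (simp add: matrix_vector_mult_diff_distrib matrix_vector_mult_scaleR l algebra_simps)
    moreover have "?x $ r = 0" by simp
    ultimately have "?x = 0" using rs unfolding rooted_simple_def by blast
    then have "b i = ((b i $ r) / (b j $ r)) *\<^sub>R b j"
      using br[of j] by (simp add: vec_eq_iff field_simps)
    moreover have "b j \<in> range b - {b i}" using ij injD[OF b(2)] by auto
    ultimately have "b i \<in> span (range b - {b i})" by (metis span_base span_scale)
    then show False using b(3) by (auto simp: dependent_def)
  qed
  \<comment> \<open>The rows of \<open>?P\<close> are left eigenvectors by symmetry, so \<open>?P\<close> diagonalises \<open>M\<close>.\<close>
  have PM: "?P ** (mat z - M) = (\<chi> i j. if i = j then z - l i else 0) ** ?P" for z
  proof -
    have "(?P ** (mat z - M)) $ i = z *\<^sub>R b i - M *v b i" for i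
    proof -
      have "(?P ** (mat z - M)) $ i $ j = z * b i $ j - (M *v b i) $ j" for j
      proof -
        have "M $ k $ j = M $ j $ k" for k using sym by (metis transpose_def vec_lambda_beta)
        then have "(\<Sum>k\<in>UNIV. b i $ k * M $ k $ j) = (M *v b i) $ j"
          unfolding matrix_vector_mult_def by (simp only: vec_lambda_beta mult.commute)
        moreover have "(\<Sum>k\<in>UNIV. b i $ k * (mat z :: real^'n^'n) $ k $ j) = z * b i $ j"
          by (simp add: mat_def if_distrib cong: if_cong)
        ultimately show ?thesis
          by (simp add: matrix_matrix_mult_def right_diff_distrib sum_subtractf)
      qed
      then show ?thesis by (simp add: vec_eq_iff)
    qed
    then show ?thesis
      by (simp add: vec_eq_iff l matrix_matrix_mult_def if_distrib if_distribR algebra_simps cong: if_cong)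
  qed
  have dets: "det (mat z - M) = (\<Prod>i\<in>UNIV. z - l i)" for z
  proof -
    have "det ?P * det (mat z - M) = (\<Prod>i\<in>UNIV. z - l i) * det ?P"
      unfolding det_mul[symmetric] PM by (subst det_mul, subst det_diagonal) auto
    then show ?thesis using b(4) by simp
  qed
  let ?M = "map_matrix complex_of_real M"
  let ?q = "\<Prod>i\<in>UNIV. [:- complex_of_real (l i), 1:]"
  \<comment> \<open>The comparison is at real arguments, where \<open>dets\<close> applies;
    agreement on this infinite set identifies the two complex polynomials.\<close>
  have "poly (charpoly ?M) (complex_of_real z) = poly ?q (complex_of_real z)" for z
  proof -
    have "mat (complex_of_real z) - ?M = map_matrix complex_of_real (mat z - M)"
      by (simp add: vec_eq_iff map_matrix_def mat_def)
    then show ?thesis by (simp add: poly_charpoly det_complex_of_real dets poly_prod)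
  qed
  then have "range complex_of_real \<subseteq> {x. poly (charpoly ?M - ?q) x = 0}" by auto
  moreover have "infinite (range complex_of_real)"
    by (simp add: finite_image_iff inj_of_real infinite_UNIV_char_0)
  ultimately have "infinite {x. poly (charpoly ?M - ?q) x = 0}"
    using finite_subset by blast
  then have "charpoly ?M - ?q = 0"
    using poly_roots_finite by blast
  then have q: "charpoly ?M = ?q" by simp
  show ?thesis
    unfolding only_simple_eigenvalues_def Let_def
  proof (intro allI impI)
    \<comment> \<open>A complex eigenvalue is a root of \<open>?q\<close>, hence one of the real
      \<open>l j\<close>.\<close>
    fix \<mu> assume "eigenvalue ?M \<mu>"
    then obtain v where v: "v \<noteq> 0" "?M *v v = \<mu> *s v" by (auto simp: eigenvalue_def)
    have "mat \<mu> *v v = \<mu> *s v"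
      by (simp add: vec_eq_iff matrix_vector_mult_def mat_def if_distrib if_distribR cong: if_cong)
    then have "(mat \<mu> - ?M) *v v = 0" using v(2) by (simp add: matrix_vector_mult_diff_rdistrib)
    then have "det (mat \<mu> - ?M) = 0"
      using v(1) by (metis invertible_det_nz invertible_left_inverse matrix_left_invertible_ker)
    then have "poly ?q \<mu> = 0" by (simp add: q[symmetric] poly_charpoly)
    then obtain j where "\<mu> = complex_of_real (l j)" by (auto simp: poly_prod)
    moreover have "inj (\<lambda>i. complex_of_real (l i))"
      using \<open>inj l\<close> by (auto simp: inj_def)
    ultimately show "order \<mu> (charpoly ?M) = 1"
      unfolding q using order_prod_linear[of "\<lambda>i. complex_of_real (l i)" j] by simp
  qed
qed

section \<open>Weighted Laplacians\<close>

lemma transpose_laplacian: "transpose (laplacian E \<gamma>) = laplacian E \<gamma>"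
  by (simp add: laplacian_def adjacency_matrix_def degree_matrix_def transpose_def vec_eq_iff
      insert_commute)

text \<open>The degree is a sum over edges; reindexing it by the other endpoint lets the adjacency
  and degree terms combine into differences along edges.\<close>

lemma laplacian_mult_component:
  assumes "simple_graph E"
  shows "(laplacian E \<gamma> *v x) $ i = (\<Sum>j\<in>UNIV. if {i, j} \<in> E then \<gamma> {i, j} * (x $ j - x $ i) else 0)"
proof -
  have "bij_betw (\<lambda>j. {i, j}) {j. {i, j} \<in> E} {e \<in> E. i \<in> e}"
  proof (rule bij_betw_imageI)
    show "inj_on (\<lambda>j. {i, j}) {j. {i, j} \<in> E}" by (auto simp: inj_on_def doubleton_eq_iff)
    show "(\<lambda>j. {i, j}) ` {j. {i, j} \<in> E} = {e \<in> E. i \<in> e}"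
    proof (intro equalityI subsetI)
      fix e assume e: "e \<in> {e \<in> E. i \<in> e}"
      then obtain a b where "e = {a, b}" using assms by (auto simp: simple_graph_def)
      with e show "e \<in> (\<lambda>j. {i, j}) ` {j. {i, j} \<in> E}" by (auto simp: insert_commute)
    qed auto
  qed
  from sum.reindex_bij_betw[OF this, of \<gamma>]
  have deg: "(\<Sum>e | e \<in> E \<and> i \<in> e. \<gamma> e) = (\<Sum>j\<in>UNIV. if {i, j} \<in> E then \<gamma> {i, j} else 0)"
    by (simp add: sum.If_cases)
  have "(laplacian E \<gamma> *v x) $ i = (\<Sum>j\<in>UNIV. (if {i, j} \<in> E then \<gamma> {i, j} else 0) * x $ j)
      - (\<Sum>j\<in>UNIV. (if i = j then \<Sum>e | e \<in> E \<and> i \<in> e. \<gamma> e else 0) * x $ j)"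
    by (simp add: laplacian_def adjacency_matrix_def degree_matrix_def matrix_vector_mult_def
        left_diff_distrib sum_subtractf)
  also have "(\<Sum>j\<in>UNIV. (if i = j then \<Sum>e | e \<in> E \<and> i \<in> e. \<gamma> e else 0) * x $ j)
      = (\<Sum>e | e \<in> E \<and> i \<in> e. \<gamma> e) * x $ i"
    by (simp add: if_distribR if_distrib[of "\<lambda>a. a * _"] cong: if_cong)
  also have "\<dots> = (\<Sum>j\<in>UNIV. (if {i, j} \<in> E then \<gamma> {i, j} else 0) * x $ i)"
    by (simp only: deg sum_distrib_right)
  finally show ?thesis
    by (simp only: sum_subtractf[symmetric]) (auto intro!: sum.cong simp: right_diff_distrib)
qed

lemma laplacian_lincomb:
  "laplacian E (\<lambda>e. \<gamma> e + t * \<delta> e) = laplacian E \<gamma> + t *\<^sub>R laplacian E \<delta>"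
  by (simp add: laplacian_def adjacency_matrix_def degree_matrix_def vec_eq_iff sum.distrib
      sum_distrib_left algebra_simps)

lemma laplacian_cong:
  assumes "\<And>e. e \<in> E \<Longrightarrow> \<gamma> e = \<delta> e"
  shows "laplacian E \<gamma> = laplacian E \<delta>"
  using assms by (simp add: laplacian_def adjacency_matrix_def degree_matrix_def vec_eq_iff)

text \<open>One edge of weight 1 contributes a rank-one matrix, minus the outer square of
  \<open>axis u 1 - axis v 1\<close>.\<close>

lemma laplacian_single_edge_mult:
  assumes E: "simple_graph E" and uv: "{u, v} \<in> E" "u \<noteq> v"
  shows "laplacian E (\<lambda>e. if e = {u, v} then 1 else 0) *v x
    = (x $ v - x $ u) *\<^sub>R (axis u 1 - axis v 1)"
proof -
  let ?L = "laplacian E (\<lambda>e. if e = {u, v} then 1 else 0)"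
  have "(?L *v x) $ i = (\<Sum>j\<in>UNIV. if i = u \<and> j = v \<or> i = v \<and> j = u then x $ j - x $ i else 0)" for i
    unfolding laplacian_mult_component[OF E]
    using uv by (intro sum.cong) (auto simp: doubleton_eq_iff insert_commute)
  moreover have "(\<Sum>j\<in>UNIV. if i = u \<and> j = v \<or> i = v \<and> j = u then x $ j - x $ i else 0)
     = (if i = u then x $ v - x $ u else if i = v then x $ u - x $ v else 0)" for i
    using uv(2) by (cases "i = u"; cases "i = v") (auto cong: if_cong)
  ultimately show ?thesis using uv(2)
    by (auto simp: vec_eq_iff axis_def)
qed

text \<open>The all-ones vector lies in the kernel, and the matrix is symmetric.\<close>

lemma laplacian_mult_sum_zero:
  assumes "simple_graph E"
  shows "(\<Sum>i\<in>UNIV. (laplacian E \<gamma> *v x) $ i) = 0"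
proof -
  have "laplacian E \<gamma> *v 1 = 0"
    by (simp add: vec_eq_iff laplacian_mult_component[OF assms] cong: if_cong)
  then have "1 \<bullet> (laplacian E \<gamma> *v x) = 0"
    by (simp add: inner_symmetric_matrix[OF transpose_laplacian])
  then show ?thesis by (simp add: inner_vec_def)
qed

section \<open>Growing a tree by light edges\<close>

text \<open>Compactness of the unit sphere supplies the subsequence; the eigenvalues converge along
  it because they are Rayleigh quotients of the \<open>x k\<close>.\<close>

lemma eigenvector_perturbation_limit:
  fixes A S :: "real^'n^'n"
  assumes "\<And>k. (A + h k *\<^sub>R S) *v x k = l k *\<^sub>R x k" and "\<And>k. norm (x k) = 1"
    and h: "h \<longlonglongrightarrow> 0"
  obtains f y m where "strict_mono f" "(x \<circ> f) \<longlonglongrightarrow> y" "norm y = 1" "A *v y = m *\<^sub>R y"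
proof -
  have "compact (sphere (0::real^'n) 1)" by simp
  moreover have "\<forall>k. x k \<in> sphere 0 1" using assms by simp
  ultimately obtain y f where y: "y \<in> sphere 0 1" "strict_mono f" "(x \<circ> f) \<longlonglongrightarrow> y"
    unfolding compact_def by metis
  let ?B = "\<lambda>k. (A + h (f k) *\<^sub>R S) *v x (f k)"
  have hf: "(\<lambda>k. h (f k)) \<longlonglongrightarrow> 0"
    using LIMSEQ_subseq_LIMSEQ[OF h y(2)] by (simp add: o_def)
  have xf: "(\<lambda>k. x (f k)) \<longlonglongrightarrow> y" using y(3) by (simp add: o_def)
  have Ml: "(\<lambda>k. (M::real^'n^'n) *v x (f k)) \<longlonglongrightarrow> M *v y" for M
    using xf bounded_linear.tendsto[OF matrix_vector_mul_bounded_linear] by blast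
  have "(\<lambda>k. A *v x (f k) + h (f k) *\<^sub>R (S *v x (f k))) \<longlonglongrightarrow> A *v y + 0 *\<^sub>R (S *v y)"
    by (intro tendsto_intros Ml hf)
  then have B: "?B \<longlonglongrightarrow> A *v y"
    by (simp add: matrix_vector_mult_add_rdistrib scaleR_matrix_vector_assoc)
  have "l (f k) = x (f k) \<bullet> ?B k" for k
    using assms(1,2)[of "f k"] by (simp add: norm_eq_1)
  then have "(\<lambda>k. l (f k)) \<longlonglongrightarrow> y \<bullet> (A *v y)"
    using tendsto_inner[OF xf B] by simp
  then have "(\<lambda>k. l (f k) *\<^sub>R x (f k)) \<longlonglongrightarrow> (y \<bullet> (A *v y)) *\<^sub>R y"
    using xf by (intro tendsto_intros)
  then have "A *v y = (y \<bullet> (A *v y)) *\<^sub>R y"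
    using B assms(1) LIMSEQ_unique by simp
  with that y show ?thesis by simp
qed

text \<open>If no weight worked, all weights \<open>1 / (k + 1)\<close> would fail, each with a unit
  eigenvector vanishing at \<open>r\<close>. A limit point of these is refuted by \<open>rs\<close>
  and the zero entry sums.\<close>

lemma rooted_simple_add_leaf:
  fixes E :: "'n::finite set set"
  assumes E: "simple_graph E" and uv: "{u, v} \<in> E" "u \<in> U" "v \<notin> U" and r: "r \<in> U"
    and supp: "\<And>e. \<not> e \<subseteq> U \<Longrightarrow> \<gamma> e = 0"
    and rs: "rooted_simple (laplacian E \<gamma>) U r"
  shows "\<exists>h. rooted_simple (laplacian E (\<lambda>e. \<gamma> e + h * (if e = {u, v} then 1 else 0))) (insert v U) r"
proof (rule ccontr)
  let ?L = "laplacian E \<gamma>"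
  let ?\<delta> = "\<lambda>e. if e = {u, v} then 1 else 0 :: real"
  let ?S = "laplacian E ?\<delta>"
  define h where "h k = inverse (real (Suc k))" for k
  have h: "h k > 0" for k by (simp add: h_def)
  \<comment> \<open>No edge at \<open>v\<close> is contained in \<open>U\<close>, so
    \<open>\<gamma>\<close> is 0 there and row \<open>v\<close> of \<open>?L\<close>
    vanishes.\<close>
  have L0: "(?L *v x) $ v = 0" for x
    using uv(3) by (simp add: laplacian_mult_component[OF E] supp cong: if_cong)
  have uv': "u \<noteq> v" using uv by auto
  assume "\<nexists>h. rooted_simple (laplacian E (\<lambda>e. \<gamma> e + h * (if e = {u, v} then 1 else 0))) (insert v U) r"
  then have "\<forall>k. \<exists>x l. (?L + h k *\<^sub>R ?S) *v x = l *\<^sub>R x \<and> (\<forall>i. i \<notin> insert v U \<longrightarrow> x $ i = 0)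
      \<and> x $ r = 0 \<and> x \<noteq> 0"
    unfolding laplacian_lincomb rooted_simple_def by blast
  then obtain x0 l where x0: "\<And>k. (?L + h k *\<^sub>R ?S) *v x0 k = l k *\<^sub>R x0 k"
    "\<And>k i. i \<notin> insert v U \<Longrightarrow> x0 k $ i = 0" "\<And>k. x0 k $ r = 0" "\<And>k. x0 k \<noteq> 0"
    by metis
  define x where "x k = (1 / norm (x0 k)) *\<^sub>R x0 k" for k
  have x: "(?L + h k *\<^sub>R ?S) *v x k = l k *\<^sub>R x k" "norm (x k) = 1" "x k $ r = 0"
      "i \<notin> insert v U \<Longrightarrow> x k $ i = 0" for k i
    using x0(1)[of k] x0(2)[of i k] x0(3,4)[of k] by (auto simp: x_def matrix_vector_mult_scaleR)
  have comp: "(?L *v x k) $ i + h k * ((x k $ v - x k $ u) * (axis u 1 $ i - axis v 1 $ i)) = l k * x k $ i" for k i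
    using arg_cong[OF x(1)[of k], of "\<lambda>y. y $ i"]
    by (simp add: matrix_vector_mult_add_rdistrib scaleR_matrix_vector_assoc[symmetric]
        laplacian_single_edge_mult[OF E uv(1) uv'])
  \<comment> \<open>For eigenvalue 0, row \<open>v\<close> forces equal entries at \<open>u\<close>
    and \<open>v\<close>. The new edge then contributes nothing, and clearing the
    \<open>v\<close>-entry leaves a null vector of \<open>?L\<close> supported in \<open>U\<close>,
    which is 0 by \<open>rs\<close>.\<close>
  have l0: "l k \<noteq> 0" for k
  proof
    assume l: "l k = 0"
    have "h k * (x k $ v - x k $ u) = 0"
      using comp[of k v] uv' by (auto simp: L0 l axis_def)
    then have eq: "x k $ v = x k $ u" using h[of k] by (metis less_irrefl mult_eq_0_iff right_minus_eq)
    define y where "y = (\<chi> i. if i = v then 0 else x k $ i)"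
    have y_nth: "y $ i = x k $ i" if "i \<noteq> v" for i using that by (simp add: y_def)
    have "?L *v y = ?L *v x k"
      unfolding vec_eq_iff laplacian_mult_component[OF E]
      by (auto simp: y_def supp uv(3) intro!: sum.cong)
    also have "\<dots> = 0 *\<^sub>R y"
      using comp[of k] by (simp add: vec_eq_iff eq l)
    finally have "y = 0"
      using rs x(3)[of k] x(4)[of _ k] by (auto simp: rooted_simple_def y_def)
    then have "x k $ i = 0" if "i \<noteq> v" for i
      using that by (metis y_nth zero_index)
    then have "x k = 0" using eq uv' by (metis vec_eq_iff zero_index)
    with x(2)[of k] show False by simp
  qed
  have sum0: "(\<Sum>i\<in>UNIV. x k $ i) = 0" for k
  proof -
    have "l k * (\<Sum>i\<in>UNIV. x k $ i) = (\<Sum>i\<in>UNIV. (laplacian E (\<lambda>e. \<gamma> e + h k * ?\<delta> e) *v x k) $ i)"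
      unfolding laplacian_lincomb x(1) by (simp add: sum_distrib_left)
    then show ?thesis using l0[of k] laplacian_mult_sum_zero[OF E] by simp
  qed
  have "h \<longlonglongrightarrow> 0" unfolding h_def by (rule LIMSEQ_inverse_real_of_nat)
  from eigenvector_perturbation_limit[OF x(1,2) this]
  obtain f y m where f: "strict_mono f" "(x \<circ> f) \<longlonglongrightarrow> y" "norm y = 1" "?L *v y = m *\<^sub>R y"
    by metis
  have yc: "(\<lambda>k. x (f k) $ i) \<longlonglongrightarrow> y $ i" for i
    using tendsto_vec_nth[OF f(2)] by (simp add: o_def)
  have yr: "y $ r = 0" using yc[of r] x(3) by (simp add: LIMSEQ_const_iff)
  have yU: "y $ i = 0" if "i \<notin> insert v U" for i
    using yc[of i] x(4)[OF that] by (simp add: LIMSEQ_const_iff)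
  have "(\<lambda>k. \<Sum>i\<in>UNIV. x (f k) $ i) \<longlonglongrightarrow> (\<Sum>i\<in>UNIV. y $ i)"
    by (intro tendsto_sum yc)
  then have ysum: "(\<Sum>i\<in>UNIV. y $ i) = 0" by (simp add: sum0 LIMSEQ_const_iff)
  \<comment> \<open>This makes row \<open>v\<close> of the eigenvalue equation survive when the
    \<open>v\<close>-entry of \<open>y\<close> is cleared, so that \<open>rs\<close> applies to
    \<open>z\<close>.\<close>
  have mv: "m * y $ v = 0" using L0[of y] f(4) by simp
  define z where "z = (\<chi> i. if i = v then 0 else y $ i)"
  have z_nth: "z $ i = y $ i" if "i \<noteq> v" for i using that by (simp add: z_def)
  have "?L *v z = ?L *v y"
    unfolding vec_eq_iff laplacian_mult_component[OF E]
    by (auto simp: z_def supp uv(3) intro!: sum.cong)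
  also have "\<dots> = m *\<^sub>R z" using mv by (auto simp: f(4) vec_eq_iff z_def)
  finally have "z = 0"
    using rs yr yU by (auto simp: rooted_simple_def z_def)
  then have yz: "y $ i = 0" if "i \<noteq> v" for i
      using that by (metis z_nth zero_index)
  then have "(\<Sum>i\<in>UNIV. y $ i) = y $ v"
    by (subst sum.remove[of _ v]) auto
  then have "y = 0" using yz ysum by (metis vec_eq_iff zero_index)
  with f(3) show False by simp
qed

text \<open>Otherwise \<open>U\<close> would be closed under adjacency and contain every vertex
  reachable from \<open>r\<close>.\<close>

lemma connected_graph_crossing_edge:
  assumes "connected_graph E" and "r \<in> U" and "U \<noteq> UNIV"
  obtains u v where "{u, v} \<in> E" "u \<in> U" "v \<notin> U"
proof -
  obtain w where w: "w \<notin> U" using assms by auto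
  have "(r, w) \<in> {(u, v). {u, v} \<in> E}\<^sup>*" using assms by (simp add: connected_graph_def)
  then have "w \<in> U" if "\<nexists>u v. {u, v} \<in> E \<and> u \<in> U \<and> v \<notin> U"
    using assms(2) that by (induction rule: rtrancl_induct) auto
  with w that show ?thesis by metis
qed

text \<open>The weighting found may vanish on edges and ignore the prescribed signs; it only
  determines the direction of a line of weightings.\<close>

lemma connected_graph_rooted_simple_laplacian:
  fixes E :: "'n::finite set set"
  assumes E: "simple_graph E" and con: "connected_graph E"
  shows "\<exists>\<gamma>. rooted_simple (laplacian E \<gamma>) UNIV r"
proof -
  define P where "P U \<longleftrightarrow> r \<in> U \<and>
      (\<exists>\<gamma>. (\<forall>e. \<not> e \<subseteq> U \<longrightarrow> \<gamma> e = 0) \<and> rooted_simple (laplacian E \<gamma>) U r)" for U :: "'n set"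
  \<comment> \<open>A vector supported at \<open>r\<close> and vanishing there is 0.\<close>
  have "rooted_simple (laplacian E (\<lambda>e. 0)) {r} r"
    by (auto simp: rooted_simple_def vec_eq_iff)
  then have "P {r}" by (auto simp: P_def)
  then have "{U. P U} \<noteq> {}" by auto
  \<comment> \<open>A maximal \<open>U\<close> exists by finiteness; an edge leaving it would
    enlarge it.\<close>
  then obtain U where U: "P U" and max: "\<And>V. P V \<Longrightarrow> U \<subseteq> V \<Longrightarrow> U = V"
    using finite_has_maximal[of "{U. P U}"] by (auto simp del: Collect_empty_eq)
  have "U = UNIV"
  proof (rule ccontr)
    assume ne: "U \<noteq> UNIV"
    have r: "r \<in> U" using U by (simp add: P_def)
    obtain u v where uv: "{u, v} \<in> E" "u \<in> U" "v \<notin> U"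
      using connected_graph_crossing_edge[OF con r ne] by metis
    obtain \<gamma> where g: "\<And>e. \<not> e \<subseteq> U \<Longrightarrow> \<gamma> e = 0" "rooted_simple (laplacian E \<gamma>) U r"
      using U by (auto simp: P_def)
    define \<gamma>' where "\<gamma>' h e = \<gamma> e + h * (if e = {u, v} then 1 else 0)" for h e
    obtain h where "rooted_simple (laplacian E (\<gamma>' h)) (insert v U) r"
      using rooted_simple_add_leaf[OF E uv r g] unfolding \<gamma>'_def by blast
    moreover have "\<gamma>' h e = 0" if "\<not> e \<subseteq> insert v U" for e
      using that g(1)[of e] uv(2) by (auto simp: \<gamma>'_def)
    ultimately have "P (insert v U)" unfolding P_def using r by blast
    then show False using max uv(3) by blast
  qed
  then show ?thesis using U by (auto simp: P_def)
qed

section \<open>Density along a line of weightings\<close>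

text \<open>The determinant is a polynomial in \<open>t\<close>, nonzero because of its value at
  \<open>t0\<close>; its finitely many roots do not accumulate at 0.\<close>

lemma eventually_det_krylov_line:
  fixes A B :: "real^'n^'n"
  assumes "det (krylov (A + t0 *\<^sub>R B) r \<kappa>) \<noteq> 0"
  shows "eventually (\<lambda>t. det (krylov (A + t *\<^sub>R B) r \<kappa>) \<noteq> 0) (at_right 0)"
proof -
  define c where "c k t = (((*v) (A + t *\<^sub>R B)) ^^ k) (axis r (1::real))" for k t
  have "\<exists>p. \<forall>i t. c k t $ i = poly (p i) t" for k
  proof (induction k)
    case 0
    show ?case by (intro exI[of _ "\<lambda>i. [:axis r 1 $ i:]"]) (simp add: c_def)
  next
    case (Suc k)
    then obtain p where p: "\<And>i t. c k t $ i = poly (p i) t" by blast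
    \<comment> \<open>The factor \<open>[:A $ i $ j, B $ i $ j:]\<close> is the matrix entry as a
      linear polynomial in \<open>t\<close>.\<close>
    have "c (Suc k) t $ i = poly (\<Sum>j\<in>UNIV. [:A $ i $ j, B $ i $ j:] * p j) t" for i t
      using p by (simp add: c_def matrix_vector_mult_def poly_sum algebra_simps)
    then show ?case by (intro exI[of _ "\<lambda>i. \<Sum>j\<in>UNIV. [:A $ i $ j, B $ i $ j:] * p j"]) blast
  qed
  then obtain p where p: "\<And>k i t. c k t $ i = poly (p k i) t" by metis
  define q where "q = (\<Sum>\<pi> | \<pi> permutes (UNIV::'n set). [:of_int (sign \<pi>):] * (\<Prod>i\<in>UNIV. p (\<kappa> i) (\<pi> i)))"
  have q: "det (krylov (A + t *\<^sub>R B) r \<kappa>) = poly q t" for t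
    by (simp add: det_def q_def krylov_def poly_sum poly_prod p[symmetric] c_def)
  then have "q \<noteq> 0" using assms by auto
  then have "finite {t. poly q t = 0}" by (rule poly_roots_finite)
  then have "eventually (\<lambda>t. t \<notin> {t. poly q t = 0}) (at 0)"
    using islimpt_finite islimpt_iff_eventually by blast
  then show ?thesis by (simp add: q eventually_at_split)
qed

theorem theorem3p1:
  fixes E :: "'n::finite set set" and \<sigma> :: "'n set \<Rightarrow> sign"
  assumes "simple_graph E" and "connected_graph E"
  shows "(\<forall>\<gamma>\<in>consistent_weightings E \<sigma>. \<forall>\<epsilon>>0.
            \<exists>\<gamma>'\<in>consistent_weightings E \<sigma>.
              weighting_norm E (\<lambda>e. \<gamma> e - \<gamma>' e) < \<epsilon> \<and>
              only_simple_eigenvalues (laplacian E \<gamma>'))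
       \<and> Metric_space.mtopology (consistent_weightings E \<sigma>) (weighting_dist E) closure_of
           {\<gamma>\<in>consistent_weightings E \<sigma>. only_simple_eigenvalues (laplacian E \<gamma>)}
         = consistent_weightings E \<sigma>"
proof -
  \<comment> \<open>Both conjuncts follow from this: the first by unfolding the distance, the second
    because every ball meets the set.\<close>
  have dense: "\<exists>\<gamma>'\<in>consistent_weightings E \<sigma>.
      weighting_dist E \<gamma> \<gamma>' < \<epsilon> \<and> only_simple_eigenvalues (laplacian E \<gamma>')"
    if \<gamma>: "\<gamma> \<in> consistent_weightings E \<sigma>" and \<epsilon>: "\<epsilon> > 0" for \<gamma> \<epsilon>
  proof -
    \<comment> \<open>Any vertex serves as the root.\<close>
    fix r :: 'n
    obtain \<gamma>0 where "rooted_simple (laplacian E \<gamma>0) UNIV r"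
      using connected_graph_rooted_simple_laplacian[OF assms] by blast
    then obtain \<kappa> where \<kappa>: "det (krylov (laplacian E \<gamma>0) r \<kappa>) \<noteq> 0"
      using rooted_simple_krylov transpose_laplacian by metis
    \<comment> \<open>The line \<open>\<gamma> + t * \<delta>\<close> passes through the given
      weighting at \<open>t = 0\<close> and through \<open>\<gamma>0\<close> at
      \<open>t = 1\<close>.\<close>
    define \<delta> where "\<delta> e = \<gamma>0 e - \<gamma> e" for e
    let ?A = "laplacian E \<gamma>" and ?B = "laplacian E \<delta>"
    have "?B = laplacian E \<gamma>0 - ?A" unfolding \<delta>_def by (rule laplacian_diff)
    then have "det (krylov (?A + 1 *\<^sub>R ?B) r \<kappa>) \<noteq> 0" using \<kappa> by simp
    then have ev1: "eventually (\<lambda>t. det (krylov (?A + t *\<^sub>R ?B) r \<kappa>) \<noteq> 0) (at_right 0)"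
      by (rule eventually_det_krylov_line)
    have sgn: "eventually (\<lambda>t. has_sign (\<gamma> e + t * \<delta> e) (\<sigma> e)) (at_right 0)" if "e \<in> E" for e
    proof -
      have "((\<lambda>t. \<gamma> e + t * \<delta> e) \<longlongrightarrow> \<gamma> e + 0 * \<delta> e) (at_right 0)"
        by (intro tendsto_intros)
      then have lim: "((\<lambda>t. \<gamma> e + t * \<delta> e) \<longlongrightarrow> \<gamma> e) (at_right 0)" by simp
      have "has_sign (\<gamma> e) (\<sigma> e)"
        using \<gamma> that by (auto simp: consistent_weightings_def)
      then show ?thesis
        using order_tendstoD[OF lim] by (cases "\<sigma> e") auto
    qed
    have ev2: "eventually (\<lambda>t. \<forall>e\<in>E. has_sign (\<gamma> e + t * \<delta> e) (\<sigma> e)) (at_right 0)"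
      by (intro eventually_ball_finite ballI sgn) auto
    have "((\<lambda>t. t * onorm ((*v) ?B)) \<longlongrightarrow> 0 * onorm ((*v) ?B)) (at_right 0)"
      by (intro tendsto_intros)
    then have ev3: "eventually (\<lambda>t. t * onorm ((*v) ?B) < \<epsilon>) (at_right 0)"
      using order_tendstoD(2) \<epsilon> by fastforce
    have ev4: "eventually (\<lambda>t::real. t > 0) (at_right 0)" by (rule eventually_at_right_less)
    obtain t where t: "det (krylov (?A + t *\<^sub>R ?B) r \<kappa>) \<noteq> 0"
      "\<And>e. e \<in> E \<Longrightarrow> has_sign (\<gamma> e + t * \<delta> e) (\<sigma> e)" "t * onorm ((*v) ?B) < \<epsilon>" "t > 0"
      using eventually_happens'[OF trivial_limit_at_right_real
          eventually_conj[OF ev1 eventually_conj[OF ev2 eventually_conj[OF ev3 ev4]]]] by blast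
    \<comment> \<open>Restriction makes \<open>\<gamma>'\<close> extensional, as the function space
      demands, and leaves the Laplacian unchanged.\<close>
    define \<gamma>' where "\<gamma>' = restrict (\<lambda>e. \<gamma> e + t * \<delta> e) E"
    have L: "laplacian E \<gamma>' = ?A + t *\<^sub>R ?B"
      unfolding laplacian_lincomb[symmetric] by (rule laplacian_cong) (simp add: \<gamma>'_def)
    have "\<gamma>' \<in> consistent_weightings E \<sigma>"
      using t(2) by (auto simp: \<gamma>'_def consistent_weightings_def)
    moreover have "weighting_dist E \<gamma> \<gamma>' < \<epsilon>"
    proof -
      have "?A *v x - laplacian E \<gamma>' *v x = (- t) *\<^sub>R (?B *v x)" for x
        by (simp add: L matrix_vector_mult_add_rdistrib flip: scaleR_matrix_vector_assoc)
      then show ?thesis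
        using t(3,4) onorm_scaleR[OF matrix_vector_mul_bounded_linear, of "- t" ?B]
        by (simp add: weighting_dist_eq)
    qed
    moreover have "only_simple_eigenvalues (laplacian E \<gamma>')"
      using t(1) transpose_laplacian krylov_rooted_simple rooted_simple_imp_only_simple_eigenvalues
      unfolding L[symmetric] by metis
    ultimately show ?thesis by blast
  qed
  interpret Metric_space "consistent_weightings E \<sigma>" "weighting_dist E"
    by (rule Metric_space_weightings[OF assms(1)])
  have "mtopology closure_of {\<gamma>\<in>consistent_weightings E \<sigma>. only_simple_eigenvalues (laplacian E \<gamma>)}
      = consistent_weightings E \<sigma>"
    (is "_ closure_of ?S = ?W")
  proof -
    have "\<exists>\<gamma>'\<in>?S. \<gamma>' \<in> mball \<gamma> \<epsilon>" if \<gamma>: "\<gamma> \<in> ?W" and \<epsilon>: "\<epsilon> > 0" for \<gamma> \<epsilon>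
      using dense[OF \<gamma> \<epsilon>] \<gamma> by auto
    then show ?thesis unfolding metric_closure_of by blast
  qed
  moreover have "\<forall>\<gamma>\<in>consistent_weightings E \<sigma>. \<forall>\<epsilon>>0. \<exists>\<gamma>'\<in>consistent_weightings E \<sigma>.
      weighting_norm E (\<lambda>e. \<gamma> e - \<gamma>' e) < \<epsilon> \<and> only_simple_eigenvalues (laplacian E \<gamma>')"
    using dense unfolding weighting_dist_def by (intro ballI allI impI)
  ultimately show ?thesis by (intro conjI)
qed

end
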